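(* Let $n\geq 1$ and $d_1,\ldots,d_n\geq 1$ be given integers. Then there exists a non-empty dense Zariski open set $U\subseteq\Omega_n(d_1,\ldots,d_n)$ such that, for every $F\in U$, the mapping $F:\mathbb{C}^n\to\mathbb{C}^n$ is proper with respect to the usual topology in $\mathbb{C}^n$.
   Context: $\Omega_n(d_1,\ldots,d_n)$ denotes the set of all polynomial mappings $F=(f_1,\ldots,f_n):\mathbb{C}^n\to\mathbb{C}^n$ such that each $f_i$ is a complex polynomial in $n$ variables of degree less than or equal to $d_i$ (the zero polynomial is allowed). Listing the coefficients of $f_1,\ldots,f_n$ identifies $\Omega_n(d_1,\ldots,d_n)$ with an affine space $\mathbb{C}^N$, and it is given the corresponding Zariski topology: closed sets are the common zero sets of polynomials in these coefficients. A continuous map is proper if the preimage of every compact set is compact; the usual topology on $\mathbb{C}^n$ is the Euclidean one. *)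

theory Defs
  imports "HOL-Analysis.Analysis" "HOL-Library.Poly_Mapping"
begin

(* Complex polynomials in variables indexed by 'v: finitely supported families of
   coefficients indexed by exponent vectors, with the convolution product of Poly_Mapping. *)
type_synonym 'v cpoly = "('v \<Rightarrow>\<^sub>0 nat) \<Rightarrow>\<^sub>0 complex"

definition monom_eval :: "('v \<Rightarrow> complex) \<Rightarrow> ('v \<Rightarrow>\<^sub>0 nat) \<Rightarrow> complex" where
  "monom_eval x m = (\<Prod>v\<in>Poly_Mapping.keys m. x v ^ Poly_Mapping.lookup m v)"

definition cpoly_eval :: "('v \<Rightarrow> complex) \<Rightarrow> 'v cpoly \<Rightarrow> complex" where
  "cpoly_eval x p =
     (\<Sum>m\<in>Poly_Mapping.keys p. Poly_Mapping.lookup p m * monom_eval x m)"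

definition monom_degree :: "('v \<Rightarrow>\<^sub>0 nat) \<Rightarrow> nat" where
  "monom_degree m = (\<Sum>v\<in>Poly_Mapping.keys m. Poly_Mapping.lookup m v)"

(* The zero polynomial gets total degree 0, so it satisfies every degree bound. *)
definition total_degree :: "'v cpoly \<Rightarrow> nat" where
  "total_degree p = Max (insert 0 (monom_degree ` Poly_Mapping.keys p))"

definition cpoly_vars :: "'v cpoly \<Rightarrow> 'v set" where
  "cpoly_vars p = (\<Union>m\<in>Poly_Mapping.keys p. Poly_Mapping.keys m)"

(* A polynomial mapping of n-space is the tuple of its component polynomials; both the
   variables and the components are indexed by the finite type 'n, with n = CARD('n). *)
definition poly_map :: "('n::finite \<Rightarrow> 'n cpoly) \<Rightarrow> complex ^ 'n \<Rightarrow> complex ^ 'n" where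
  "poly_map F x = (\<chi> i. cpoly_eval (\<lambda>j. x $ j) (F i))"

definition Omega :: "('n::finite \<Rightarrow> nat) \<Rightarrow> ('n \<Rightarrow> 'n cpoly) set" where
  "Omega d = {F. \<forall>i. total_degree (F i) \<le> d i}"

(* The coordinates of the affine space Omega d: the pair (i, m) stands for the
   coefficient of the monomial m in the i-th component. *)
definition coeff_index :: "('n::finite \<Rightarrow> nat) \<Rightarrow> ('n \<times> ('n \<Rightarrow>\<^sub>0 nat)) set" where
  "coeff_index d = {(i, m). monom_degree m \<le> d i}"

definition coeffs_of :: "('n \<Rightarrow> 'n cpoly) \<Rightarrow> 'n \<times> ('n \<Rightarrow>\<^sub>0 nat) \<Rightarrow> complex" where
  "coeffs_of F = (\<lambda>(i, m). Poly_Mapping.lookup (F i) m)"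

definition zariski_closed ::
    "('n::finite \<Rightarrow> nat) \<Rightarrow> ('n \<Rightarrow> 'n cpoly) set \<Rightarrow> bool" where
  "zariski_closed d C \<longleftrightarrow>
     (\<exists>P :: ('n \<times> ('n \<Rightarrow>\<^sub>0 nat)) cpoly set.
        (\<forall>p\<in>P. cpoly_vars p \<subseteq> coeff_index d) \<and>
        C = {F \<in> Omega d. \<forall>p\<in>P. cpoly_eval (coeffs_of F) p = 0})"

definition zariski :: "('n::finite \<Rightarrow> nat) \<Rightarrow> ('n \<Rightarrow> 'n cpoly) topology" where
  "zariski d = topology (\<lambda>U. U \<subseteq> Omega d \<and> zariski_closed d (Omega d - U))"

definition proper_mapping ::
    "('a::topological_space \<Rightarrow> 'b::topological_space) \<Rightarrow> bool" where
  "proper_mapping f \<longleftrightarrow> continuous_on UNIV f \<and> (\<forall>K. compact K \<longrightarrow> compact (f -` K))"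

lemma monom_eval_superset:
  assumes "finite A" "Poly_Mapping.keys m \<subseteq> A"
  shows "monom_eval x m = (\<Prod>v\<in>A. x v ^ Poly_Mapping.lookup m v)"
  unfolding monom_eval_def
  by (rule prod.mono_neutral_left) (use assms in \<open>auto simp: in_keys_iff\<close>)

lemma monom_eval_add: "monom_eval x (m + m') = monom_eval x m * monom_eval x m'"
proof -
  let ?A = "Poly_Mapping.keys m \<union> Poly_Mapping.keys m'"
  have "Poly_Mapping.keys (m + m') \<subseteq> ?A" by (rule keys_add)
  then show ?thesis
    by (simp add: monom_eval_superset[of ?A] lookup_add power_add prod.distrib)
qed

lemma cpoly_eval_superset:
  assumes "finite A" "Poly_Mapping.keys p \<subseteq> A"
  shows "cpoly_eval x p = (\<Sum>m\<in>A. Poly_Mapping.lookup p m * monom_eval x m)"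
  unfolding cpoly_eval_def
  by (rule sum.mono_neutral_left) (use assms in \<open>auto simp: in_keys_iff\<close>)

lemma cpoly_eval_zero [simp]: "cpoly_eval x 0 = 0"
  by (simp add: cpoly_eval_def)

lemma cpoly_eval_add: "cpoly_eval x (p + q) = cpoly_eval x p + cpoly_eval x q"
proof -
  let ?A = "Poly_Mapping.keys p \<union> Poly_Mapping.keys q"
  have "Poly_Mapping.keys (p + q) \<subseteq> ?A" by (rule keys_add)
  then show ?thesis
    by (simp add: cpoly_eval_superset[of ?A] lookup_add distrib_right sum.distrib)
qed

lemma cpoly_eval_single:
  "cpoly_eval x (Poly_Mapping.single m c) = c * monom_eval x m"
  by (simp add: cpoly_eval_superset[of "{m}"])

lemma cpoly_eval_one [simp]: "cpoly_eval x 1 = 1"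
  using cpoly_eval_single[of x 0 1] by (simp add: monom_eval_def)

lemma update_conv_add:
  assumes "m \<notin> Poly_Mapping.keys p"
  shows "Poly_Mapping.update m c p = p + Poly_Mapping.single m c"
  using assms
  by (intro poly_mapping_eqI) (auto simp: lookup_update lookup_add lookup_single in_keys_iff when_def)

lemma cpoly_eval_mult: "cpoly_eval x (p * q) = cpoly_eval x p * cpoly_eval x q"
proof (induction p rule: update_induct)
  case const
  show ?case by simp
next
  case (update p m c)
  have "cpoly_eval x (Poly_Mapping.single m c * q) = c * monom_eval x m * cpoly_eval x q"
  proof (induction q rule: update_induct)
    case const
    show ?case by simp
  next
    case (update q m' c')
    then show ?case
      by (simp add: update_conv_add cpoly_eval_add cpoly_eval_single mult_single
          monom_eval_add algebra_simps)
  qed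
  then show ?case
    using update by (simp add: update_conv_add cpoly_eval_add cpoly_eval_single algebra_simps)
qed

lemma cpoly_vars_mult: "cpoly_vars (p * q) \<subseteq> cpoly_vars p \<union> cpoly_vars q"
proof
  fix v assume "v \<in> cpoly_vars (p * q)"
  then obtain m where m: "m \<in> Poly_Mapping.keys (p * q)" "v \<in> Poly_Mapping.keys m"
    by (auto simp: cpoly_vars_def)
  then obtain a b where ab: "m = a + b" "a \<in> Poly_Mapping.keys p" "b \<in> Poly_Mapping.keys q"
    using keys_mult[of p q] by blast
  then have "v \<in> Poly_Mapping.keys a \<union> Poly_Mapping.keys b"
    using m(2) keys_add[of a b] by blast
  then show "v \<in> cpoly_vars p \<union> cpoly_vars q"
    using ab by (auto simp: cpoly_vars_def)
qed

lemma zariski_closed_empty: "zariski_closed d {}"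
  unfolding zariski_closed_def by (rule exI[of _ "{1}"]) (simp add: cpoly_vars_def)

lemma zariski_closed_Omega: "zariski_closed d (Omega d)"
  unfolding zariski_closed_def by (rule exI[of _ "{}"]) simp

lemma zariski_closed_Un:
  assumes "zariski_closed d C" "zariski_closed d D"
  shows "zariski_closed d (C \<union> D)"
proof -
  obtain P Q where
    P: "\<forall>p\<in>P. cpoly_vars p \<subseteq> coeff_index d"
       "C = {F \<in> Omega d. \<forall>p\<in>P. cpoly_eval (coeffs_of F) p = 0}" and
    Q: "\<forall>q\<in>Q. cpoly_vars q \<subseteq> coeff_index d"
       "D = {F \<in> Omega d. \<forall>q\<in>Q. cpoly_eval (coeffs_of F) q = 0}"
    using assms unfolding zariski_closed_def by blast
  let ?R = "{p * q | p q. p \<in> P \<and> q \<in> Q}"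
  have "\<forall>r\<in>?R. cpoly_vars r \<subseteq> coeff_index d"
  proof clarify
    fix p q v
    assume "p \<in> P" "q \<in> Q" "v \<in> cpoly_vars (p * q)"
    with cpoly_vars_mult[of p q] have "v \<in> cpoly_vars p \<union> cpoly_vars q" by blast
    with \<open>p \<in> P\<close> \<open>q \<in> Q\<close> show "v \<in> coeff_index d" using P(1) Q(1) by auto
  qed
  moreover have "C \<union> D = {F \<in> Omega d. \<forall>r\<in>?R. cpoly_eval (coeffs_of F) r = 0}"
  proof -
    have "(\<forall>r\<in>?R. cpoly_eval x r = 0) \<longleftrightarrow>
        (\<forall>p\<in>P. cpoly_eval x p = 0) \<or> (\<forall>q\<in>Q. cpoly_eval x q = 0)" for x
    proof -
      have "(\<forall>r\<in>?R. cpoly_eval x r = 0) \<longleftrightarrow>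
          (\<forall>p\<in>P. \<forall>q\<in>Q. cpoly_eval x (p * q) = 0)"
        by auto
      then show ?thesis by (auto simp: cpoly_eval_mult)
    qed
    then show ?thesis unfolding P(2) Q(2) by blast
  qed
  ultimately show ?thesis unfolding zariski_closed_def by blast
qed

lemma zariski_closed_INT:
  assumes "\<And>C. C \<in> \<C> \<Longrightarrow> zariski_closed d C"
  shows "zariski_closed d (Omega d \<inter> \<Inter>\<C>)"
proof -
  have "\<forall>C\<in>\<C>. \<exists>P. (\<forall>p\<in>P. cpoly_vars p \<subseteq> coeff_index d) \<and>
      C = {F \<in> Omega d. \<forall>p\<in>P. cpoly_eval (coeffs_of F) p = 0}"
    using assms unfolding zariski_closed_def by blast
  from bchoice[OF this] obtain P where
    P: "\<forall>C\<in>\<C>. (\<forall>p\<in>P C. cpoly_vars p \<subseteq> coeff_index d) \<and>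
      C = {F \<in> Omega d. \<forall>p\<in>P C. cpoly_eval (coeffs_of F) p = 0}" ..
  have vars: "cpoly_vars p \<subseteq> coeff_index d" if "C \<in> \<C>" "p \<in> P C" for C p
    by (rule bspec[OF conjunct1[OF bspec[OF P that(1)]] that(2)])
  note eq = conjunct2[OF bspec[OF P]]
  have mem: "F \<in> C \<longleftrightarrow> F \<in> Omega d \<and> (\<forall>p\<in>P C. cpoly_eval (coeffs_of F) p = 0)"
    if "C \<in> \<C>" for F C
    using eqset_imp_iff[OF eq[OF that], of F] by simp
  have "\<forall>p\<in>(\<Union>C\<in>\<C>. P C). cpoly_vars p \<subseteq> coeff_index d"
    by (intro ballI) (erule UN_E, rule vars)
  moreover have "Omega d \<inter> \<Inter>\<C> =
      {F \<in> Omega d. \<forall>p\<in>(\<Union>C\<in>\<C>. P C). cpoly_eval (coeffs_of F) p = 0}"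
    using mem by auto
  ultimately show ?thesis unfolding zariski_closed_def by blast
qed

lemma istopology_zariski:
  "istopology (\<lambda>U. U \<subseteq> Omega d \<and> zariski_closed d (Omega d - U))"
  unfolding istopology_def
proof (intro conjI allI impI)
  fix S T
  assume "S \<subseteq> Omega d \<and> zariski_closed d (Omega d - S)"
    and "T \<subseteq> Omega d \<and> zariski_closed d (Omega d - T)"
  then show "S \<inter> T \<subseteq> Omega d" "zariski_closed d (Omega d - S \<inter> T)"
    by (auto simp: Diff_Int zariski_closed_Un)
next
  fix \<K>
  assume K: "\<forall>K\<in>\<K>. K \<subseteq> Omega d \<and> zariski_closed d (Omega d - K)"
  show "\<Union>\<K> \<subseteq> Omega d" using K by blast
  have "zariski_closed d (Omega d \<inter> \<Inter>((\<lambda>K. Omega d - K) ` \<K>))"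
    by (rule zariski_closed_INT) (use K in blast)
  also have "Omega d \<inter> \<Inter>((\<lambda>K. Omega d - K) ` \<K>) = Omega d - \<Union>\<K>"
    by blast
  finally show "zariski_closed d (Omega d - \<Union>\<K>)" .
qed

lemma openin_zariski:
  "openin (zariski d) U \<longleftrightarrow> U \<subseteq> Omega d \<and> zariski_closed d (Omega d - U)"
  unfolding zariski_def by (simp add: istopology_zariski)

lemma topspace_zariski: "topspace (zariski d) = Omega d"
proof
  show "topspace (zariski d) \<subseteq> Omega d"
    by (metis openin_topspace openin_zariski)
  have "openin (zariski d) (Omega d)"
    by (simp add: openin_zariski zariski_closed_empty)
  then show "Omega d \<subseteq> topspace (zariski d)" by (rule openin_subset)
qed

lemma closedin_zariski: "closedin (zariski d) C \<longleftrightarrow> zariski_closed d C"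
proof -
  have "zariski_closed d C \<Longrightarrow> C \<subseteq> Omega d"
    unfolding zariski_closed_def by blast
  then show ?thesis
    by (auto simp: closedin_def topspace_zariski openin_zariski double_diff)
qed

end

theory Submission
  imports Defs "Jordan_Normal_Form.Determinant"
begin

text \<open>
  If the homogeneous parts of degrees \<open>d\<^sub>i\<close> of the components \<open>f\<^sub>i\<close> have no common zero besides the origin, then \<open>F\<close>
  grows at infinity and is proper. The point is to see that this is a Zariski open condition,
  and that it holds somewhere. Instead of the full theory of the resultant, one
  Macaulay determinant suffices.

  Put \<open>D = 1 + \<Sum>\<^sub>i (d\<^sub>i - 1)\<close>. By the pigeonhole principle every monomial \<open>m\<close> of degree
  \<open>D\<close> is divisible by some \<open>x\<^sub>i\<close> to the power \<open>d\<^sub>i\<close>; let \<open>s\<close> be the quotient. The part of degree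
  \<open>D\<close> of \<open>s f\<^sub>i\<close> is a combination of the monomials of degree \<open>D\<close>, and its coefficients form
  the row \<open>m\<close> of a square matrix, the Macaulay matrix, whose entries are
  coefficients of \<open>F\<close> or zero. Its determinant \<open>\<Delta>\<close> is therefore a polynomial in the
  coefficients of \<open>F\<close>, and it takes the value 1 at the mapping whose components are the pure
  powers of the variables, because there the matrix is the identity. The set \<open>U\<close> is the
  locus where \<open>\<Delta>\<close> does not vanish.

  If \<open>\<Delta>\<close> does not vanish at \<open>F\<close>, the adjugate of the matrix
  expresses every monomial of degree \<open>D\<close> through the sums over the rows. Such a sum
  is \<open>s f\<^sub>i\<close> minus terms of degree less than \<open>D\<close>. If \<open>r \<ge> 1\<close> is the largest absolute value of a
  coordinate of \<open>x\<close> and all \<open>f\<^sub>i(x)\<close> are bounded by \<open>b\<close>, the sums are therefore at most a constant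
  times \<open>r\<close> to the power \<open>D - 1\<close>, whereas one of the monomials has
  absolute value \<open>r\<close> to the power \<open>D\<close> (\<open>bounded_if_values_bounded\<close>). So \<open>r\<close> is bounded:
  preimages of bounded sets are bounded, which for a continuous map of these spaces is
  properness.

  Density holds for every non-empty locus \<open>q \<noteq> 0\<close>: two polynomials on an affine space, neither
  of them zero as a function, are both non-zero at some point of a suitable line
  (\<open>common_nonvanishing_point\<close>).
\<close>

section \<open>Monomials and their degrees\<close>

lemma monom_degree_eq_sum:
  "monom_degree m = (\<Sum>v\<in>UNIV. Poly_Mapping.lookup m (v :: 'n::finite))"
  unfolding monom_degree_def
  by (rule sum.mono_neutral_left) (auto simp: in_keys_iff)

lemma monom_degree_add:
  "monom_degree (a + b) = monom_degree a + monom_degree (b :: 'n::finite \<Rightarrow>\<^sub>0 nat)"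
  by (simp add: monom_degree_eq_sum lookup_add sum.distrib)

lemma monom_degree_single: "monom_degree (Poly_Mapping.single v e) = e"
  by (cases "e = 0") (auto simp: monom_degree_def)

lemma monom_eval_single: "monom_eval x (Poly_Mapping.single v e) = x v ^ e"
  by (subst monom_eval_superset[of "{v}"]) auto

lemma finite_monom_degree_le: "finite {m :: 'n::finite \<Rightarrow>\<^sub>0 nat. monom_degree m \<le> D}"
proof -
  have "Poly_Mapping.lookup m v \<le> D" if "monom_degree m \<le> D" for m :: "'n \<Rightarrow>\<^sub>0 nat" and v
    using member_le_sum[of v UNIV "Poly_Mapping.lookup m"] that
    by (simp add: monom_degree_eq_sum)
  then have "Poly_Mapping.lookup ` {m :: 'n \<Rightarrow>\<^sub>0 nat. monom_degree m \<le> D}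
      \<subseteq> PiE UNIV (\<lambda>_. {..D})"
    by (auto simp: PiE_def)
  moreover have "finite (PiE (UNIV :: 'n set) (\<lambda>_. {..D}))"
    by (rule finite_PiE) auto
  ultimately have "finite (Poly_Mapping.lookup ` {m :: 'n \<Rightarrow>\<^sub>0 nat. monom_degree m \<le> D})"
    by (rule finite_subset)
  then show ?thesis
    by (rule finite_imageD) (auto intro: inj_onI poly_mapping_eqI)
qed

lemma finite_monom_degree_eq: "finite {m :: 'n::finite \<Rightarrow>\<^sub>0 nat. monom_degree m = D}"
  by (rule finite_subset[OF _ finite_monom_degree_le[of D]]) auto

lemma norm_monom_eval_le:
  assumes "\<And>v. norm (x v) \<le> r"
  shows "norm (monom_eval x m) \<le> r ^ monom_degree m"
proof -
  have "norm (monom_eval x m) =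
      (\<Prod>v\<in>Poly_Mapping.keys m. norm (x v) ^ Poly_Mapping.lookup m v)"
    by (simp add: monom_eval_def prod_norm[symmetric] norm_power)
  also have "\<dots> \<le> (\<Prod>v\<in>Poly_Mapping.keys m. r ^ Poly_Mapping.lookup m v)"
    by (intro prod_mono) (auto intro: power_mono assms)
  also have "\<dots> = r ^ monom_degree m"
    by (simp add: monom_degree_def power_sum)
  finally show ?thesis .
qed

lemma total_degree_le_iff:
  "total_degree p \<le> e \<longleftrightarrow> (\<forall>m. Poly_Mapping.lookup p m \<noteq> 0 \<longrightarrow> monom_degree m \<le> e)"
  by (auto simp: total_degree_def in_keys_iff)

lemma cpoly_eval_bounded_degree:
  fixes F :: "'n::finite \<Rightarrow> 'n cpoly"
  assumes "F \<in> Omega d"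
  shows "cpoly_eval x (F i) =
    (\<Sum>k | monom_degree k \<le> d i. Poly_Mapping.lookup (F i) k * monom_eval x k)"
  by (rule cpoly_eval_superset[OF finite_monom_degree_le])
     (use assms in \<open>auto simp: Omega_def total_degree_le_iff in_keys_iff\<close>)

section \<open>Determinants of matrices of polynomials\<close>

lemma cpoly_vars_add: "cpoly_vars (p + q) \<subseteq> cpoly_vars p \<union> cpoly_vars q"
  using keys_add[of p q] by (auto simp: cpoly_vars_def)

lemma cpoly_vars_sum:
  "(\<And>a. a \<in> A \<Longrightarrow> cpoly_vars (f a) \<subseteq> V) \<Longrightarrow> cpoly_vars (sum f A) \<subseteq> V"
proof (induction A rule: infinite_finite_induct)
  case (insert a A)
  then show ?case
    using cpoly_vars_add[of "f a" "sum f A"] by force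
qed (auto simp: cpoly_vars_def)

lemma cpoly_vars_prod:
  "(\<And>a. a \<in> A \<Longrightarrow> cpoly_vars (f a) \<subseteq> V) \<Longrightarrow> cpoly_vars (prod f A) \<subseteq> V"
proof (induction A rule: infinite_finite_induct)
  case (insert a A)
  then show ?case
    using cpoly_vars_mult[of "f a" "prod f A"] by force
qed (auto simp: cpoly_vars_def)

text \<open>
  The membership of \<open>\<Delta>\<close> in the coordinate ring of the coefficient space has to be tracked
  separately, since closed sets are cut out only by polynomials in the coordinates of that space.
\<close>

lemma cpoly_vars_det:
  assumes "A \<in> carrier_mat n n"
    and "\<And>i j. i < n \<Longrightarrow> j < n \<Longrightarrow> cpoly_vars (A $$ (i, j)) \<subseteq> V"
  shows "cpoly_vars (det A) \<subseteq> V"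
  unfolding det_def'[OF assms(1)]
proof (rule cpoly_vars_sum)
  fix p assume "p \<in> {p. p permutes {0..<n}}"
  then have "p i < n" if "i < n" for i
    using that permutes_in_image[of p "{0..<n}" i] by auto
  then have "cpoly_vars (\<Prod>i = 0..<n. A $$ (i, p i)) \<subseteq> V"
    by (intro cpoly_vars_prod assms(2)) auto
  then show "cpoly_vars (signof p * (\<Prod>i = 0..<n. A $$ (i, p i))) \<subseteq> V"
    by (cases rule: sign_cases[of p]) (auto simp: cpoly_vars_def)
qed

lemma comm_ring_hom_cpoly_eval: "comm_ring_hom (cpoly_eval x)"
  by unfold_locales (simp_all add: cpoly_eval_add cpoly_eval_mult)

text \<open>
  Determinant and adjugate for a matrix indexed by an arbitrary finite set, here later the
  monomials of a fixed degree: an enumeration of the index set transports the classical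
  statements. Working over the polynomial ring makes \<open>\<Delta>\<close> and \<open>N\<close> universal, so that evaluating
  them at any point yields the determinant and the adjugate of the evaluated matrix.
\<close>

lemma obtain_determinant_adjugate:
  fixes M :: "'a \<Rightarrow> 'a \<Rightarrow> 'v cpoly"
  assumes "finite A" and vars: "\<And>a b. a \<in> A \<Longrightarrow> b \<in> A \<Longrightarrow> cpoly_vars (M a b) \<subseteq> V"
  obtains \<Delta> N where "cpoly_vars \<Delta> \<subseteq> V"
    and "\<And>a b. a \<in> A \<Longrightarrow> b \<in> A \<Longrightarrow> (\<Sum>c\<in>A. N a c * M c b) = (if a = b then \<Delta> else 0)"
    and "\<And>x. (\<And>a b. a \<in> A \<Longrightarrow> b \<in> A \<Longrightarrow> cpoly_eval x (M a b) = of_bool (a = b))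
           \<Longrightarrow> cpoly_eval x \<Delta> = 1"
proof -
  define n where "n = card A"
  obtain e where e: "bij_betw e {0..<n} A"
    using ex_bij_betw_nat_finite[OF \<open>finite A\<close>] n_def by blast
  then have eA: "e i \<in> A" if "i < n" for i
    using that bij_betwE by fastforce
  have inj: "e i = e j \<longleftrightarrow> i = j" if "i < n" "j < n" for i j
    using e that by (auto simp: bij_betw_def inj_on_def)
  define B where "B = mat n n (\<lambda>(i, j). M (e i) (e j))"
  have B: "B \<in> carrier_mat n n" by (simp add: B_def)
  define g where "g = inv_into {0..<n} e"
  have g: "g a < n" "e (g a) = a" if "a \<in> A" for a
    using e that inv_into_into[of a e "{0..<n}"] f_inv_into_f[of a e "{0..<n}"]
    by (auto simp: g_def bij_betw_def)
  have ge: "g (e i) = i" if "i < n" for i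
    using g[OF eA[OF that]] inj that by blast
  define N where "N a b = adj_mat B $$ (g a, g b)" for a b
  show thesis
  proof (rule that[of "det B" N])
    show "cpoly_vars (det B) \<subseteq> V"
      by (rule cpoly_vars_det[OF B]) (simp add: B_def vars eA)
  next
    fix a b assume ab: "a \<in> A" "b \<in> A"
    have "(\<Sum>c\<in>A. N a c * M c b) = (\<Sum>i = 0..<n. N a (e i) * M (e i) b)"
      using sum.reindex_bij_betw[OF e, of "\<lambda>c. N a c * M c b"] by simp
    also have "\<dots> = (adj_mat B * B) $$ (g a, g b)"
      using adj_mat(1)[OF B] B ab g ge
      by (auto simp: N_def scalar_prod_def B_def intro!: sum.cong)
    also have "\<dots> = (if g a = g b then det B else 0)"
      using g ab by (simp add: adj_mat(3)[OF B])
    also have "g a = g b \<longleftrightarrow> a = b"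
      using g ab by metis
    finally show "(\<Sum>c\<in>A. N a c * M c b) = (if a = b then det B else 0)" .
  next
    fix x assume x: "\<And>a b. a \<in> A \<Longrightarrow> b \<in> A \<Longrightarrow> cpoly_eval x (M a b) = of_bool (a = b)"
    interpret comm_ring_hom "cpoly_eval x" by (rule comm_ring_hom_cpoly_eval)
    have "map_mat (cpoly_eval x) B = 1\<^sub>m n"
      by (rule eq_matI) (auto simp: B_def x eA inj)
    then show "cpoly_eval x (det B) = 1"
      by (metis hom_det det_one)
  qed
qed

section \<open>The Macaulay matrix\<close>

text \<open>
  For positive \<open>d i\<close> this is the least degree in which every monomial is divisible by one of the
  pure powers: the product of the variables to the powers \<open>d i - 1\<close> is not.
\<close>

definition macaulay_degree :: "('n::finite \<Rightarrow> nat) \<Rightarrow> nat" where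
  "macaulay_degree d = Suc (\<Sum>i\<in>UNIV. d i - 1)"

text \<open>
  Any choice of a pure power dividing the monomial \<open>m\<close> works. The choice depends on \<open>d\<close> only, so the
  shape of the matrix is the same for all mappings.
\<close>

definition row_component :: "('n::finite \<Rightarrow> nat) \<Rightarrow> ('n \<Rightarrow>\<^sub>0 nat) \<Rightarrow> 'n" where
  "row_component d m = (SOME i. d i \<le> Poly_Mapping.lookup m i)"

definition row_multiplier :: "('n::finite \<Rightarrow> nat) \<Rightarrow> ('n \<Rightarrow>\<^sub>0 nat) \<Rightarrow> 'n \<Rightarrow>\<^sub>0 nat" where
  "row_multiplier d m =
     m - Poly_Mapping.single (row_component d m) (d (row_component d m))"

text \<open>
  The entry is the coefficient of \<open>m'\<close> in the product of the row multiplier with the component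
  \<open>row_component d m\<close>, as a coordinate function on the space of coefficients. Subtraction of
  exponent vectors truncates, so the entry is a coordinate only if the multiplier divides \<open>m'\<close>.
\<close>

definition macaulay_entry ::
    "('n::finite \<Rightarrow> nat) \<Rightarrow> ('n \<Rightarrow>\<^sub>0 nat) \<Rightarrow> ('n \<Rightarrow>\<^sub>0 nat) \<Rightarrow> ('n \<times> ('n \<Rightarrow>\<^sub>0 nat)) cpoly" where
  "macaulay_entry d m m' =
     (if \<exists>k. m' = row_multiplier d m + k
      then Poly_Mapping.single
             (Poly_Mapping.single (row_component d m, m' - row_multiplier d m) 1) 1
      else 0)"

text \<open>
  Pigeonhole principle: a monomial with all exponents below the \<open>d i\<close> has degree at most
  \<open>\<Sum>\<^sub>i (d i - 1)\<close>, which is less than the Macaulay degree.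
\<close>

lemma row_multiplier_add:
  assumes "monom_degree m = macaulay_degree d"
  shows "m = row_multiplier d m + Poly_Mapping.single (row_component d m) (d (row_component d m))"
proof -
  have "\<exists>i. d i \<le> Poly_Mapping.lookup m i"
  proof (rule ccontr)
    assume "\<not> ?thesis"
    then have less: "Poly_Mapping.lookup m i < d i" for i
      by (simp add: not_le)
    have "Poly_Mapping.lookup m i \<le> d i - 1" for i
      using less[of i] by simp
    then have "monom_degree m \<le> (\<Sum>i\<in>UNIV. d i - 1)"
      unfolding monom_degree_eq_sum by (intro sum_mono)
    then show False using assms by (simp add: macaulay_degree_def)
  qed
  then have "d (row_component d m) \<le> Poly_Mapping.lookup m (row_component d m)"
    unfolding row_component_def by (rule someI_ex)
  then show ?thesis
    by (intro poly_mapping_eqI)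
       (auto simp: row_multiplier_def lookup_add lookup_minus lookup_single when_def)
qed

lemma monom_degree_row_multiplier:
  assumes "monom_degree m = macaulay_degree d"
  shows "monom_degree (row_multiplier d m) + d (row_component d m) = macaulay_degree d"
  using arg_cong[OF row_multiplier_add[OF assms], of monom_degree] assms
  by (simp add: monom_degree_add monom_degree_single)

lemma cpoly_vars_macaulay_entry:
  assumes "monom_degree m = macaulay_degree d" "monom_degree m' = macaulay_degree d"
  shows "cpoly_vars (macaulay_entry d m m') \<subseteq> coeff_index d"
proof (cases "\<exists>k. m' = row_multiplier d m + k")
  case True
  then obtain k where k: "m' = row_multiplier d m + k" by blast
  then have "monom_degree k = d (row_component d m)"
    using monom_degree_row_multiplier[OF assms(1)] assms(2) by (simp add: monom_degree_add)
  then show ?thesis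
    by (auto simp: k macaulay_entry_def cpoly_vars_def coeff_index_def)
qed (simp add: macaulay_entry_def cpoly_vars_def)

lemma eval_macaulay_entry_add:
  "cpoly_eval (coeffs_of F) (macaulay_entry d m (row_multiplier d m + k)) =
     Poly_Mapping.lookup (F (row_component d m)) k"
  by (auto simp: macaulay_entry_def cpoly_eval_single monom_eval_single coeffs_of_def)

definition pure_powers :: "('n::finite \<Rightarrow> nat) \<Rightarrow> 'n \<Rightarrow> 'n cpoly" where
  "pure_powers d i = Poly_Mapping.single (Poly_Mapping.single i (d i)) 1"

lemma pure_powers_in_Omega: "pure_powers d \<in> Omega d"
  by (auto simp: Omega_def pure_powers_def total_degree_le_iff lookup_single when_def
      monom_degree_single)

text \<open>
  At the pure powers the product of the row multiplier with the chosen component is the monomial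
  \<open>m\<close> itself, so the Macaulay matrix is the identity. This is what makes the determinant
  a non-zero polynomial.
\<close>

lemma macaulay_entry_pure_powers:
  assumes "monom_degree m = macaulay_degree d"
  shows "cpoly_eval (coeffs_of (pure_powers d)) (macaulay_entry d m m') = of_bool (m = m')"
proof (cases "\<exists>k. m' = row_multiplier d m + k")
  case True
  then obtain k where k: "m' = row_multiplier d m + k" by blast
  have "m = m' \<longleftrightarrow> Poly_Mapping.single (row_component d m) (d (row_component d m)) = k"
    \<comment> \<open>A single occurrence is rewritten, since \<open>m\<close> occurs again in its own decomposition.\<close>
    unfolding k by (subst (1) row_multiplier_add[OF assms]) (rule add_left_cancel)
  then show ?thesis
    unfolding k by (simp add: eval_macaulay_entry_add pure_powers_def lookup_single when_def)
next
  case False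
  then have "m \<noteq> m'"
    using row_multiplier_add[OF assms] by blast
  with False show ?thesis
    by (simp add: macaulay_entry_def)
qed

text \<open>
  Multiplication by the row multiplier embeds the monomials of degree \<open>d i\<close> into those of the
  Macaulay degree, and the entries outside the image vanish. So a row applied to the vector of
  monomials is the multiplier times the part of degree \<open>d i\<close> of the component \<open>i\<close>.
\<close>

lemma macaulay_row_sum:
  fixes x :: "'n::finite \<Rightarrow> complex"
  assumes "monom_degree m = macaulay_degree d"
  defines "i \<equiv> row_component d m"
  shows "(\<Sum>m' | monom_degree m' = macaulay_degree d.
            cpoly_eval (coeffs_of F) (macaulay_entry d m m') * monom_eval x m') =
         monom_eval x (row_multiplier d m) *
           (\<Sum>k | monom_degree k = d i. Poly_Mapping.lookup (F i) k * monom_eval x k)"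
proof -
  let ?s = "row_multiplier d m"
  let ?f = "\<lambda>m'. cpoly_eval (coeffs_of F) (macaulay_entry d m m') * monom_eval x m'"
  have deg: "monom_degree (?s + k) = macaulay_degree d \<longleftrightarrow> monom_degree k = d i" for k
    using monom_degree_row_multiplier[OF assms(1)] by (auto simp: monom_degree_add i_def)
  have "sum ?f {m'. monom_degree m' = macaulay_degree d} =
      sum ?f ((\<lambda>k. ?s + k) ` {k. monom_degree k = d i})"
  proof (rule sum.mono_neutral_right[OF finite_monom_degree_eq])
    show "(\<lambda>k. ?s + k) ` {k. monom_degree k = d i} \<subseteq> {m'. monom_degree m' = macaulay_degree d}"
      using deg by auto
    show "\<forall>m'\<in>{m'. monom_degree m' = macaulay_degree d} -
        (\<lambda>k. ?s + k) ` {k. monom_degree k = d i}. ?f m' = 0"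
    proof
      fix m' assume m': "m' \<in> {m'. monom_degree m' = macaulay_degree d} -
        (\<lambda>k. ?s + k) ` {k. monom_degree k = d i}"
      then have "\<not> (\<exists>k. m' = ?s + k)"
        using deg by auto
      then show "?f m' = 0" by (simp add: macaulay_entry_def)
    qed
  qed
  also have "\<dots> = (\<Sum>k | monom_degree k = d i. ?f (?s + k))"
    by (subst sum.reindex) (auto intro: inj_onI)
  also have "\<dots> = monom_eval x ?s *
      (\<Sum>k | monom_degree k = d i. Poly_Mapping.lookup (F i) k * monom_eval x k)"
    by (simp add: eval_macaulay_entry_add monom_eval_add sum_distrib_left i_def mult_ac)
  finally show ?thesis .
qed

section \<open>Invertibility of the Macaulay matrix implies properness\<close>

text \<open>
  The part of degree \<open>d i\<close> of a component is its value minus the terms of lower degree. The value is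
  bounded by assumption, and the lower terms gain at most the power \<open>d i - 1\<close> of \<open>r\<close>; this loss
  of one power against the degree of the row is what the growth argument exploits.
\<close>

lemma norm_macaulay_row_sum_le:
  fixes x :: "'n::finite \<Rightarrow> complex"
  assumes F: "F \<in> Omega d" and d: "\<And>i. d i \<ge> 1"
    and m: "monom_degree m = macaulay_degree d"
    and r: "1 \<le> r" "\<And>j. norm (x j) \<le> r"
    and b: "\<And>i. norm (cpoly_eval x (F i)) \<le> b"
  shows "norm (\<Sum>m' | monom_degree m' = macaulay_degree d.
            cpoly_eval (coeffs_of F) (macaulay_entry d m m') * monom_eval x m')
         \<le> r ^ (macaulay_degree d - 1) *
             (b + (\<Sum>i\<in>UNIV. \<Sum>k | monom_degree k \<le> d i. norm (Poly_Mapping.lookup (F i) k)))"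
proof -
  define i where "i = row_component d m"
  have deg: "monom_degree (row_multiplier d m) = macaulay_degree d - d i"
    and exps: "macaulay_degree d - 1 = (macaulay_degree d - d i) + (d i - 1)"
    using monom_degree_row_multiplier[OF m] d[of i] by (auto simp: i_def)
  let ?c = "\<lambda>k. Poly_Mapping.lookup (F i) k"
  let ?t = "\<lambda>k. ?c k * monom_eval x k"
  let ?S = "\<lambda>i. \<Sum>k | monom_degree k \<le> d i. norm (Poly_Mapping.lookup (F i) k)"
  have fin: "finite {k :: 'n \<Rightarrow>\<^sub>0 nat. monom_degree k < d i}"
    by (rule finite_subset[OF _ finite_monom_degree_le[of "d i"]]) auto
  have split: "{k :: 'n \<Rightarrow>\<^sub>0 nat. monom_degree k \<le> d i} =
      {k. monom_degree k = d i} \<union> {k. monom_degree k < d i}" by auto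
  have "cpoly_eval x (F i) =
      (\<Sum>k | monom_degree k = d i. ?t k) + (\<Sum>k | monom_degree k < d i. ?t k)"
    unfolding cpoly_eval_bounded_degree[OF F] split
    by (rule sum.union_disjoint) (auto simp: fin finite_monom_degree_eq)
  then have top: "(\<Sum>k | monom_degree k = d i. ?t k) =
      cpoly_eval x (F i) - (\<Sum>k | monom_degree k < d i. ?t k)" by simp
  have "0 \<le> b" using b[of i] norm_ge_zero order_trans by blast
  have one: "1 \<le> r ^ (d i - 1)" using r(1) by simp
  have "norm (\<Sum>k | monom_degree k < d i. ?t k) \<le>
      (\<Sum>k | monom_degree k < d i. r ^ (d i - 1) * norm (?c k))"
  proof (rule sum_norm_le)
    fix k assume "k \<in> {k :: 'n \<Rightarrow>\<^sub>0 nat. monom_degree k < d i}"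
    then have "r ^ monom_degree k \<le> r ^ (d i - 1)"
      using r(1) by (intro power_increasing) auto
    then have "norm (monom_eval x k) \<le> r ^ (d i - 1)"
      using norm_monom_eval_le[of x r k, OF r(2)] by linarith
    then show "norm (?t k) \<le> r ^ (d i - 1) * norm (?c k)"
      unfolding norm_mult by (subst mult.commute) (auto intro: mult_right_mono)
  qed
  also have "\<dots> \<le> (\<Sum>k | monom_degree k \<le> d i. r ^ (d i - 1) * norm (?c k))"
    using r(1) by (intro sum_mono2 finite_monom_degree_le) auto
  also have "\<dots> = r ^ (d i - 1) * ?S i"
    by (simp add: sum_distrib_left)
  also have "\<dots> \<le> r ^ (d i - 1) * (\<Sum>i\<in>UNIV. ?S i)"
    using r(1) by (intro mult_left_mono member_le_sum) (auto intro: sum_nonneg)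
  finally have low: "norm (\<Sum>k | monom_degree k < d i. ?t k) \<le> r ^ (d i - 1) * (\<Sum>i\<in>UNIV. ?S i)" .
  have "norm (cpoly_eval x (F i)) \<le> r ^ (d i - 1) * b"
    using b[of i] mult_right_mono[OF one \<open>0 \<le> b\<close>] by simp
  with low have "norm (\<Sum>k | monom_degree k = d i. ?t k) \<le> r ^ (d i - 1) * (b + (\<Sum>i\<in>UNIV. ?S i))"
    unfolding top by (intro norm_triangle_ineq4[THEN order_trans]) (simp add: distrib_left)
  moreover have "norm (monom_eval x (row_multiplier d m)) \<le> r ^ (macaulay_degree d - d i)"
    using norm_monom_eval_le[of x r "row_multiplier d m", OF r(2)] deg by simp
  ultimately have "norm (monom_eval x (row_multiplier d m) * (\<Sum>k | monom_degree k = d i. ?t k))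
      \<le> r ^ (macaulay_degree d - d i) * (r ^ (d i - 1) * (b + (\<Sum>i\<in>UNIV. ?S i)))"
    unfolding norm_mult using r(1) by (intro mult_mono) auto
  also have "\<dots> = r ^ (macaulay_degree d - 1) * (b + (\<Sum>i\<in>UNIV. ?S i))"
    by (simp only: exps power_add mult.assoc)
  finally show ?thesis
    by (simp add: macaulay_row_sum[OF m] i_def)
qed

text \<open>
  Let \<open>l\<close> be the index of a coordinate of largest absolute value \<open>r\<close>. Row \<open>x\<^sub>l\<^sup>D\<close> of the adjugate
  combines the row sums to \<open>\<delta> x\<^sub>l\<^sup>D\<close>; comparing \<open>\<bar>\<delta>\<bar> r\<^sup>D\<close> with the bound of order \<open>D - 1\<close> on the row
  sums bounds \<open>r\<close>. The estimates on powers of \<open>r\<close> require \<open>r \<ge> 1\<close>, whence the maximum with 1.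
\<close>

lemma bounded_if_values_bounded:
  fixes F :: "'n::finite \<Rightarrow> 'n cpoly"
  assumes F: "F \<in> Omega d" and d: "\<And>i. d i \<ge> 1"
    and N: "\<And>m m'. monom_degree m = macaulay_degree d \<Longrightarrow> monom_degree m' = macaulay_degree d \<Longrightarrow>
      (\<Sum>c | monom_degree c = macaulay_degree d.
         N m c * cpoly_eval (coeffs_of F) (macaulay_entry d c m')) = (if m = m' then \<delta> else 0)"
    and "\<delta> \<noteq> 0"
  obtains K where "\<And>x j. (\<And>i. norm (cpoly_eval x (F i)) \<le> b) \<Longrightarrow> norm (x j) \<le> K"
proof -
  define D where "D = macaulay_degree d"
  define A where "A = {m :: 'n \<Rightarrow>\<^sub>0 nat. monom_degree m = D}"
  have finA: "finite A" unfolding A_def by (rule finite_monom_degree_eq)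
  define S where
    "S = (\<Sum>i\<in>UNIV. \<Sum>k | monom_degree k \<le> d i. norm (Poly_Mapping.lookup (F i) k))"
  define T where "T = (\<Sum>a\<in>A. \<Sum>c\<in>A. norm (N a c))"
  let ?M = "\<lambda>c m. cpoly_eval (coeffs_of F) (macaulay_entry d c m)"
  have "norm (x j) \<le> max 1 (T * (b + S) / norm \<delta>)"
    if b: "\<And>i. norm (cpoly_eval x (F i)) \<le> b" for x j
  proof -
    have "0 \<le> b" using b[of undefined] norm_ge_zero order_trans by blast
    have "0 \<le> S" unfolding S_def by (intro sum_nonneg) auto
    obtain l where l: "\<And>j. norm (x j) \<le> norm (x l)"
    proof -
      have "Max (range (\<lambda>j. norm (x j))) \<in> range (\<lambda>j. norm (x j))"
        by (rule Max_in) auto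
      then obtain l where "Max (range (\<lambda>j. norm (x j))) = norm (x l)" by blast
      then show thesis
        by (intro that[of l]) (metis Max_ge finite_class.finite_UNIV finite_imageI rangeI)
    qed
    define r where "r = norm (x l)"
    show ?thesis
    proof (cases "1 \<le> r")
      case True
      let ?p = "Poly_Mapping.single l D"
      have p: "?p \<in> A" by (simp add: A_def monom_degree_single)
      have "(\<Sum>c\<in>A. N ?p c * (\<Sum>m\<in>A. ?M c m * monom_eval x m)) =
          (\<Sum>m\<in>A. (\<Sum>c\<in>A. N ?p c * ?M c m) * monom_eval x m)"
        unfolding sum_distrib_left sum_distrib_right
        by (subst sum.swap) (simp add: mult.assoc)
      also have "\<dots> = (\<Sum>m\<in>A. (if ?p = m then \<delta> else 0) * monom_eval x m)"
        by (intro sum.cong refl arg_cong2[where f = "(*)"])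
           (use N p in \<open>simp add: A_def D_def\<close>)
      also have "\<dots> = \<delta> * x l ^ D"
        using finA p by (simp add: if_distrib[of "\<lambda>t. t * _"] sum.delta' monom_eval_single cong: if_cong)
      finally have "norm \<delta> * r ^ D = norm (\<Sum>c\<in>A. N ?p c * (\<Sum>m\<in>A. ?M c m * monom_eval x m))"
        by (simp add: norm_mult norm_power r_def)
      also have "\<dots> \<le> (\<Sum>c\<in>A. norm (N ?p c) * (r ^ (D - 1) * (b + S)))"
      proof (rule sum_norm_le)
        fix c assume "c \<in> A"
        then have "norm (\<Sum>m\<in>A. ?M c m * monom_eval x m) \<le> r ^ (D - 1) * (b + S)"
          unfolding A_def D_def S_def
          by (intro norm_macaulay_row_sum_le[OF F d _ True _ b]) (auto simp: l r_def)
        then show "norm (N ?p c * (\<Sum>m\<in>A. ?M c m * monom_eval x m))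
            \<le> norm (N ?p c) * (r ^ (D - 1) * (b + S))"
          by (simp add: norm_mult mult_left_mono)
      qed
      also have "\<dots> = (\<Sum>c\<in>A. norm (N ?p c)) * (r ^ (D - 1) * (b + S))"
        by (simp add: sum_distrib_right)
      also have "\<dots> \<le> T * (r ^ (D - 1) * (b + S))"
        unfolding T_def using True \<open>0 \<le> b\<close> \<open>0 \<le> S\<close>
        by (intro mult_right_mono member_le_sum[OF p, of "\<lambda>a. \<Sum>c\<in>A. norm (N a c)"] finA)
           (auto intro: sum_nonneg)
      finally have "norm \<delta> * r ^ D \<le> r ^ (D - 1) * (T * (b + S))"
        by (simp add: mult_ac)
      moreover have "r ^ D = r ^ (D - 1) * r"
        by (simp add: D_def macaulay_degree_def)
      ultimately have "r ^ (D - 1) * (norm \<delta> * r) \<le> r ^ (D - 1) * (T * (b + S))"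
        by (simp add: mult_ac)
      then have "norm \<delta> * r \<le> T * (b + S)"
        using True by (subst (asm) mult_le_cancel_left_pos) auto
      then have "r \<le> T * (b + S) / norm \<delta>"
        using \<open>\<delta> \<noteq> 0\<close> by (simp add: field_simps)
      then show ?thesis using l[of j] by (simp add: r_def)
    next
      case False
      then show ?thesis using l[of j] by (simp add: r_def)
    qed
  qed
  then show thesis by (rule that)
qed

lemma proper_mapping_if_bounded:
  fixes f :: "'a::heine_borel \<Rightarrow> 'b::metric_space"
  assumes cont: "continuous_on UNIV f"
    and bdd: "\<And>K. bounded K \<Longrightarrow> bounded (f -` K)"
  shows "proper_mapping f"
  using assms
  by (auto simp: proper_mapping_def compact_eq_bounded_closed
      intro: closed_vimage compact_imp_bounded compact_imp_closed)

lemma continuous_on_poly_map: "continuous_on UNIV (poly_map F)"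
  unfolding poly_map_def cpoly_eval_def monom_eval_def
  by (intro continuous_on_vec_lambda continuous_intros)

text \<open>
  The matrix \<open>N\<close> and the number \<open>\<delta>\<close> stand for the adjugate and the determinant of the Macaulay
  matrix of \<open>F\<close>; the condition says that \<open>N\<close> is a left inverse up to the factor \<open>\<delta>\<close>.
\<close>

lemma proper_poly_map:
  fixes F :: "'n::finite \<Rightarrow> 'n cpoly"
  assumes F: "F \<in> Omega d" and d: "\<And>i. d i \<ge> 1"
    and N: "\<And>m m'. monom_degree m = macaulay_degree d \<Longrightarrow> monom_degree m' = macaulay_degree d \<Longrightarrow>
      (\<Sum>c | monom_degree c = macaulay_degree d.
         N m c * cpoly_eval (coeffs_of F) (macaulay_entry d c m')) = (if m = m' then \<delta> else 0)"
    and "\<delta> \<noteq> 0"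
  shows "proper_mapping (poly_map F)"
proof (rule proper_mapping_if_bounded[OF continuous_on_poly_map])
  fix K :: "(complex ^ 'n) set" assume "bounded K"
  then obtain b where b: "\<And>y. y \<in> K \<Longrightarrow> norm y \<le> b"
    by (auto simp: bounded_iff)
  obtain C where C: "\<And>x j. (\<And>i. norm (cpoly_eval x (F i)) \<le> b) \<Longrightarrow> norm (x j) \<le> C"
    using bounded_if_values_bounded[OF F d N \<open>\<delta> \<noteq> 0\<close>] by blast
  show "bounded (poly_map F -` K)"
    unfolding bounded_iff
  proof (intro exI ballI)
    fix x assume "x \<in> poly_map F -` K"
    then have "norm (poly_map F x) \<le> b" using b by simp
    then have "norm (cpoly_eval (vec_nth x) (F i)) \<le> b" for i
      using Finite_Cartesian_Product.norm_nth_le[of "poly_map F x" i] by (simp add: poly_map_def)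
    then have "norm (vec_nth x j) \<le> C" for j
      by (rule C)
    then have "(\<Sum>j\<in>UNIV. norm (vec_nth x j)) \<le> real CARD('n) * C"
      using sum_bounded_above[of UNIV "\<lambda>j. norm (vec_nth x j)" C] by simp
    then show "norm x \<le> real CARD('n) * C"
      using L2_set_le_sum[of UNIV "\<lambda>j. norm (vec_nth x j)"] by (simp add: norm_vec_def)
  qed
qed

section \<open>Density of principal Zariski open sets\<close>

lemma cpoly_eval_on_line:
  "\<exists>q :: complex poly. \<forall>t. poly q t = cpoly_eval (\<lambda>v. a v + t * b v) p"
proof (intro exI allI)
  fix t
  show "poly (\<Sum>m\<in>Poly_Mapping.keys p. Polynomial.smult (Poly_Mapping.lookup p m)
      (\<Prod>v\<in>Poly_Mapping.keys m. [:a v, b v:] ^ Poly_Mapping.lookup m v)) t =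
      cpoly_eval (\<lambda>v. a v + t * b v) p"
    by (simp add: cpoly_eval_def monom_eval_def poly_sum poly_prod)
qed

lemma Omega_line:
  assumes "F \<in> Omega d" "G \<in> Omega d"
  obtains H where "H \<in> Omega d"
    and "coeffs_of H = (\<lambda>v. coeffs_of F v + t * (coeffs_of G v - coeffs_of F v))"
proof -
  define H where "H i = F i + Poly_Mapping.map ((*) t) (G i - F i)" for i
  have H: "Poly_Mapping.lookup (H i) m = Poly_Mapping.lookup (F i) m +
      t * (Poly_Mapping.lookup (G i) m - Poly_Mapping.lookup (F i) m)" for i m
    by (simp add: H_def lookup_add Poly_Mapping.map.rep_eq lookup_minus when_def)
  show thesis
  proof
    show "H \<in> Omega d"
      unfolding Omega_def total_degree_le_iff mem_Collect_eq
    proof (intro allI impI)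
      fix i m assume "Poly_Mapping.lookup (H i) m \<noteq> 0"
      then have "Poly_Mapping.lookup (F i) m \<noteq> 0 \<or> Poly_Mapping.lookup (G i) m \<noteq> 0"
        by (auto simp: H)
      then show "monom_degree m \<le> d i"
        using assms by (auto simp: Omega_def total_degree_le_iff)
    qed
    show "coeffs_of H = (\<lambda>v. coeffs_of F v + t * (coeffs_of G v - coeffs_of F v))"
      by (auto simp: coeffs_of_def H)
  qed
qed

text \<open>
  Irreducibility of the affine space, proved on the line through \<open>F\<close> and \<open>G\<close>: both restrictions
  are non-zero polynomials in the parameter \<open>t\<close> (look at \<open>t = 0\<close> for \<open>p\<close> and at \<open>t = 1\<close> for \<open>q\<close>), so all
  but finitely many points of the line serve.
\<close>

lemma common_nonvanishing_point:
  assumes "F \<in> Omega d" "cpoly_eval (coeffs_of F) p \<noteq> 0"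
    and "G \<in> Omega d" "cpoly_eval (coeffs_of G) q \<noteq> 0"
  obtains H where "H \<in> Omega d"
    and "cpoly_eval (coeffs_of H) p \<noteq> 0" "cpoly_eval (coeffs_of H) q \<noteq> 0"
proof -
  let ?l = "\<lambda>t v. coeffs_of F v + t * (coeffs_of G v - coeffs_of F v)"
  obtain P where P: "\<forall>t. poly P t = cpoly_eval (?l t) p"
    using cpoly_eval_on_line[of "coeffs_of F" "\<lambda>v. coeffs_of G v - coeffs_of F v" p] ..
  obtain Q where Q: "\<forall>t. poly Q t = cpoly_eval (?l t) q"
    using cpoly_eval_on_line[of "coeffs_of F" "\<lambda>v. coeffs_of G v - coeffs_of F v" q] ..
  have "P \<noteq> 0" using P[rule_format, of 0] assms(2) by auto
  moreover have "Q \<noteq> 0" using Q[rule_format, of 1] assms(4) by auto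
  ultimately have "finite {t. poly (P * Q) t = 0}"
    by (intro poly_roots_finite) simp
  then obtain t where "t \<notin> {t. poly (P * Q) t = 0}"
    using ex_new_if_finite[OF infinite_UNIV_char_0] by blast
  then have "cpoly_eval (?l t) p \<noteq> 0" "cpoly_eval (?l t) q \<noteq> 0"
    using P Q by auto
  moreover obtain H where "H \<in> Omega d" "coeffs_of H = ?l t"
    by (rule Omega_line[OF assms(1,3), of t])
  ultimately show thesis using that[of H] by simp
qed

definition principal_open :: "('n::finite \<Rightarrow> nat) \<Rightarrow> ('n \<times> ('n \<Rightarrow>\<^sub>0 nat)) cpoly
    \<Rightarrow> ('n \<Rightarrow> 'n cpoly) set" where
  "principal_open d p = {F \<in> Omega d. cpoly_eval (coeffs_of F) p \<noteq> 0}"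

lemma openin_principal_open:
  assumes "cpoly_vars p \<subseteq> coeff_index d"
  shows "openin (zariski d) (principal_open d p)"
  unfolding openin_zariski zariski_closed_def
  by (intro conjI exI[of _ "{p}"]) (use assms in \<open>auto simp: principal_open_def\<close>)

text \<open>
  A polynomial that vanishes on the non-empty locus \<open>p \<noteq> 0\<close> vanishes everywhere, for otherwise it
  would be non-zero together with \<open>p\<close> at some point. Hence every equation of the closure holds on the whole space.
\<close>

lemma closure_of_principal_open:
  assumes "principal_open d p \<noteq> {}"
  shows "(zariski d) closure_of (principal_open d p) = Omega d"
proof
  show "(zariski d) closure_of (principal_open d p) \<subseteq> Omega d"
    using closure_of_subset_topspace[of "zariski d"] by (simp add: topspace_zariski)
  obtain G where G: "G \<in> Omega d" "cpoly_eval (coeffs_of G) p \<noteq> 0"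
    using assms by (auto simp: principal_open_def)
  have "zariski_closed d ((zariski d) closure_of (principal_open d p))"
    by (simp flip: closedin_zariski)
  then obtain Q where Q: "(zariski d) closure_of (principal_open d p) =
      {F \<in> Omega d. \<forall>q\<in>Q. cpoly_eval (coeffs_of F) q = 0}"
    unfolding zariski_closed_def by blast
  have sub: "principal_open d p \<subseteq> (zariski d) closure_of (principal_open d p)"
    by (rule closure_of_subset) (auto simp: principal_open_def topspace_zariski)
  show "Omega d \<subseteq> (zariski d) closure_of (principal_open d p)"
  proof
    fix F assume F: "F \<in> Omega d"
    have "cpoly_eval (coeffs_of F) q = 0" if "q \<in> Q" for q
    proof (rule ccontr)
      assume "cpoly_eval (coeffs_of F) q \<noteq> 0"
      then obtain H where "H \<in> principal_open d p" "cpoly_eval (coeffs_of H) q \<noteq> 0"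
        using common_nonvanishing_point[OF F _ G] by (auto simp: principal_open_def)
      with sub Q \<open>q \<in> Q\<close> show False by blast
    qed
    with F Q show "F \<in> (zariski d) closure_of (principal_open d p)" by blast
  qed
qed

section \<open>Generic polynomial mappings are proper\<close>

theorem lemma3p8:
  fixes d :: "'n::finite \<Rightarrow> nat"
  assumes "\<And>i. d i \<ge> 1"
  shows "\<exists>U. openin (zariski d) U \<and> U \<noteq> {} \<and> (zariski d) closure_of U = Omega d \<and>
           (\<forall>F\<in>U. proper_mapping (poly_map F))"
proof -
  let ?A = "{m :: 'n \<Rightarrow>\<^sub>0 nat. monom_degree m = macaulay_degree d}"
  obtain \<Delta> N where vars: "cpoly_vars \<Delta> \<subseteq> coeff_index d"
    and N: "\<And>a b. a \<in> ?A \<Longrightarrow> b \<in> ?A \<Longrightarrow>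
      (\<Sum>c\<in>?A. N a c * macaulay_entry d c b) = (if a = b then \<Delta> else 0)"
    and one: "\<And>x. (\<And>a b. a \<in> ?A \<Longrightarrow> b \<in> ?A \<Longrightarrow>
      cpoly_eval x (macaulay_entry d a b) = of_bool (a = b)) \<Longrightarrow> cpoly_eval x \<Delta> = 1"
    using obtain_determinant_adjugate[of ?A "macaulay_entry d" "coeff_index d"]
      finite_monom_degree_eq cpoly_vars_macaulay_entry by blast
  have "cpoly_eval (coeffs_of (pure_powers d)) \<Delta> = 1"
    by (rule one) (simp add: macaulay_entry_pure_powers)
  then have "pure_powers d \<in> principal_open d \<Delta>"
    by (simp add: principal_open_def pure_powers_in_Omega)
  then have ne: "principal_open d \<Delta> \<noteq> {}" by blast
  have "proper_mapping (poly_map F)" if "F \<in> principal_open d \<Delta>" for F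
  proof (rule proper_poly_map[of F d "\<lambda>a c. cpoly_eval (coeffs_of F) (N a c)"])
    show "F \<in> Omega d" "cpoly_eval (coeffs_of F) \<Delta> \<noteq> 0"
      using that by (auto simp: principal_open_def)
    interpret comm_ring_hom "cpoly_eval (coeffs_of F)" by (rule comm_ring_hom_cpoly_eval)
    fix m m' :: "'n \<Rightarrow>\<^sub>0 nat"
    assume "monom_degree m = macaulay_degree d" "monom_degree m' = macaulay_degree d"
    then have "cpoly_eval (coeffs_of F) (\<Sum>c\<in>?A. N m c * macaulay_entry d c m') =
        (if m = m' then cpoly_eval (coeffs_of F) \<Delta> else 0)"
      by (simp add: N)
    then show "(\<Sum>c\<in>?A. cpoly_eval (coeffs_of F) (N m c) *
        cpoly_eval (coeffs_of F) (macaulay_entry d c m')) =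
        (if m = m' then cpoly_eval (coeffs_of F) \<Delta> else 0)"
      by (simp add: hom_sum hom_mult)
  qed (rule assms)
  then show ?thesis
    using openin_principal_open[OF vars] closure_of_principal_open[OF ne] ne by blast
qed

end
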